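(* Let $I_\nu$ be the Infeld (modified Bessel) function and let $\Psi(\nu,x)$ be the function defined in the context. (i) If $\nu>\frac12$ and $2x_0>\nu-\frac12$, or if $0\le\nu<\frac12$ and $2x_0>\nu+\frac32$, then for all $x\ge x_0$ $$\left|\frac{I_\nu(x)}{\left(\frac{e^x}{\sqrt{2\pi x}}\right)}-1\right|\le\Psi(\nu,x).$$ (ii) If $\nu=\frac12$, then for all $x>0$ $$\left|\frac{I_\nu(x)}{\left(\frac{e^x}{\sqrt{2\pi x}}\right)}-1\right|\le\Psi(\nu,x)=e^{-2x}.$$
   Context: For real $\nu\ge0$ and $x>0$, $I_\nu(x):=\sum_{k=0}^\infty\frac{(x/2)^{\nu+2k}}{\Gamma(k+1)\Gamma(k+\nu+1)}$. Define $$\Psi(\nu,x):=e^{-2x}+\left(\frac{|4\nu^2-1|}{8x}+G(\nu,x)\cdot\frac{|(4\nu^2-1)(4\nu^2-9)|}{32x^2}\right)(1+e^{-2x}),$$ where $G(\nu,x)=\left(1-\frac{\nu-\frac12}{2x}\right)^{-2\nu-1}$ if $\nu\ge\frac12$, and $G(\nu,x)=\left(1-\frac{\nu+\frac32}{2x}\right)^{-\nu-\frac32}\left(1+\frac{2\nu+2}{x}\right)$ if $0\le\nu<\frac12$. For $\nu=\frac12$ one has $\Psi(\frac12,x)=e^{-2x}$. *)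

theory Defs
  imports "HOL-Analysis.Gamma_Function"
begin

(* Meant for x > 0, where powr is the usual real power. *)
definition bessel_I :: "real \<Rightarrow> real \<Rightarrow> real" where
  "bessel_I \<nu> x =
     (\<Sum>k. (x / 2) powr (\<nu> + 2 * real k) / (Gamma (real k + 1) * Gamma (real k + \<nu> + 1)))"

definition Psi_G :: "real \<Rightarrow> real \<Rightarrow> real" where
  "Psi_G \<nu> x =
     (if \<nu> \<ge> 1/2 then (1 - (\<nu> - 1/2) / (2 * x)) powr (- 2 * \<nu> - 1)
      else (1 - (\<nu> + 3/2) / (2 * x)) powr (- \<nu> - 3/2) * (1 + (2 * \<nu> + 2) / x))"

definition Psi :: "real \<Rightarrow> real \<Rightarrow> real" where
  "Psi \<nu> x =
     exp (- 2 * x) +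
     (\<bar>4 * \<nu>\<^sup>2 - 1\<bar> / (8 * x) +
      Psi_G \<nu> x * (\<bar>(4 * \<nu>\<^sup>2 - 1) * (4 * \<nu>\<^sup>2 - 9)\<bar> / (32 * x\<^sup>2))) * (1 + exp (- 2 * x))"

end

theory Submission
  imports Defs "HOL-Analysis.Analysis"
begin

text \<open>
  Put \<open>a = \<nu> - 1/2\<close> and \<open>L = 2 * x\<close>. Expanding the exponential in Poisson's integral
  gives the series of \<open>I\<^sub>\<nu>\<close> term by term, and after rescaling the quotient
  \<open>R = I\<^sub>\<nu>(x) / (e\<^sup>x / sqrt (2 * pi * x))\<close> satisfies
  \<open>Gamma (a + 1) * R = (integral of s\<^sup>a * (1 - s/L)\<^sup>a * e\<^sup>-\<^sup>s over 0 \<le> s \<le> L)\<close>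
  (lemma \<open>bessel_ratio_integral\<close>). If the factor \<open>(1 - s/L)\<^sup>a\<close> and the cut-off at \<open>L\<close> were
  absent, the integral would be \<open>Gamma (a + 1)\<close>. So the error \<open>R - 1\<close> measures the
  deviation of the truncated factor from 1, and Taylor's formula for
  \<open>(1 - y)\<^sup>a\<close> with \<open>y = s/L\<close> turns its successive terms into Gamma integrals:
  up to sign, the linear term gives \<open>a * (a + 1) / L = (4 * \<nu>\<^sup>2 - 1) / (8 * x)\<close>, the quadratic term
  gives \<open>(4 * \<nu>\<^sup>2 - 1) * (4 * \<nu>\<^sup>2 - 9) / (128 * x\<^sup>2)\<close>, and the part of the Gamma integral beyond \<open>L\<close>
  accounts for \<open>e\<^sup>-\<^sup>2\<^sup>x\<close>.

  The second order coefficient \<open>1/32\<close> of \<open>Psi\<close> is four times the one of Taylor's formula. This slack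
  has to absorb the cubic remainder, which is singular at \<open>y = 1\<close>, and the cut-off. It is large
  enough; what enters of \<open>G\<close> is the lower bound \<open>G \<ge> 1\<close>. In detail:

  \<^item> For \<open>a \<ge> 1\<close>, Bernoulli's inequality \<open>(1 - y)\<^sup>a \<ge> 1 - a * y\<close> leaves only the linear term.

  \<^item> For \<open>0 < a < 1\<close> and for \<open>-1/2 \<le> a < 0\<close>, the remainder after the quadratic term is at most
    \<open>y\<^sup>3\<close> times an explicit function of the size of \<open>1 / sqrt (1 - y)\<close>. Since \<open>s\<^sup>a * s\<^sup>3 * e\<^sup>-\<^sup>s\<close> is bounded,
    one may pull \<open>s\<^sup>a * y\<^sup>3 * e\<^sup>-\<^sup>s\<close> out of the integral as a constant over \<open>L\<^sup>3\<close>, and what remains has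
    integral of order \<open>L\<close>. The result is of order \<open>1 / L\<^sup>2\<close>, uniformly in \<open>L\<close>.

  \<^item> The opposite inequality is immediate from \<open>(1 - y)\<^sup>a \<le> 1\<close> for \<open>a \<ge> 0\<close>; for
    \<open>a \<le> 0\<close> one has \<open>(1 - y)\<^sup>a \<ge> 1\<close>, so that only the missing tail beyond \<open>L\<close> counts.
\<close>

section \<open>Poisson's integral for the modified Bessel function\<close>

lemma Gamma_legendre_duplication_real:
  fixes z :: real
  assumes "z > 0"
  shows "Gamma z * Gamma (z + 1/2) = 2 powr (1 - 2*z) * sqrt pi * Gamma (2*z)"
proof -
  have nonpole: "complex_of_real w \<notin> \<int>\<^sub>\<le>\<^sub>0" if "w > 0" for w
    using that by (auto elim!: nonpos_Ints_cases simp: complex_eq_iff)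
  have "Gamma (complex_of_real z) * Gamma (of_real z + 1/2) =
          exp ((1 - 2 * of_real z) * of_real (ln 2)) * of_real (sqrt pi) * Gamma (2 * of_real z)"
    using nonpole[of z] nonpole[of "z + 1/2"] assms
    by (intro Gamma_legendre_duplication) auto
  also have "of_real z + 1/2 = complex_of_real (z + 1/2)" by simp
  also have "2 * of_real z = complex_of_real (2 * z)" by simp
  also have "(1 - complex_of_real (2 * z)) * of_real (ln 2) = of_real ((1 - 2 * z) * ln 2)" by simp
  finally have "complex_of_real (Gamma z * Gamma (z + 1/2)) =
      of_real (exp ((1 - 2*z) * ln 2) * sqrt pi * Gamma (2*z))"
    by (simp only: Gamma_complex_of_real exp_of_real of_real_mult flip: of_real_mult)
  hence "Gamma z * Gamma (z + 1/2) = exp ((1 - 2*z) * ln 2) * sqrt pi * Gamma (2*z)"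
    by (simp only: of_real_eq_iff)
  thus ?thesis by (simp add: powr_def)
qed

lemma Gamma_plus1_pos: "x > 0 \<Longrightarrow> Gamma (x + 1) = x * Gamma (x :: real)"
  by (rule Gamma_plus1) (auto elim!: nonpos_Ints_cases)

lemma symmetric_beta_weight_plus1:
  fixes a y :: real
  assumes "0 \<le> y" "y \<le> 1"
  shows "y powr (a + 1) * (1 - y) powr (a + 1) = y * (1 - y) * (y powr a * (1 - y) powr a)"
  using assms by (simp add: powr_add)

text \<open>The induction avoids any substitution: \<open>(1 - 2*y)\<^sup>2 = 1 - 4 * y * (1 - y)\<close>, so raising the moment by
  one step costs the same moment with the exponent \<open>a\<close> raised by 1. Hence the induction runs over all \<open>a\<close>
  at once and starts from the Beta integral, rewritten by the duplication formula. The closed form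
  passes to the next \<open>k\<close> by the functional equation of Gamma.\<close>
lemma has_integral_even_moment:
  fixes a :: real
  assumes "a > -1"
  shows "((\<lambda>y. (1 - 2*y) ^ (2*k) * (y powr a * (1 - y) powr a)) has_integral
           (2 powr (- 2*a - 1) * Gamma (real k + 1/2) * Gamma (a + 1) / Gamma (real k + a + 3/2))) {0..1}"
  using assms
proof (induction k arbitrary: a)
  case 0
  define p :: real where "p = 2 powr (- 2*a - 1)"
  have exps: "2 * (a + 1) = 2*a + 2" "a + 1 + 1/2 = a + 3/2" "1 - (2*a + 2) = - 2*a - 1" by simp_all
  have "Gamma (a + 1) * Gamma (a + 3/2) = p * sqrt pi * Gamma (2*a + 2)"
    using Gamma_legendre_duplication_real[of "a + 1"] 0 unfolding p_def exps by auto
  moreover have "Gamma (a + 3/2) > 0" "Gamma (2*a + 2) > 0" using 0 by auto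
  ultimately have "Beta (a + 1) (a + 1) = p * Gamma (1/2) * Gamma (a + 1) / Gamma (a + 3/2)"
    unfolding Beta_def by (simp add: field_simps Gamma_one_half_real)
  hence "Beta (a + 1) (a + 1) = 2 powr (- 2*a - 1) * Gamma (1/2) * Gamma (a + 1) / Gamma (a + 3/2)"
    unfolding p_def .
  thus ?case using has_integral_Beta_real[of "a + 1" "a + 1"] 0 by simp
next
  case (Suc k)
  define M where
    "M = (\<lambda>k a. 2 powr (- 2*a - 1) * Gamma (real k + 1/2) * Gamma (a + 1) / Gamma (real k + a + 3/2))"
  have "((\<lambda>y. (1 - 2*y) ^ (2*k) * (y powr a * (1 - y) powr a)
             - 4 * ((1 - 2*y) ^ (2*k) * (y powr (a + 1) * (1 - y) powr (a + 1)))) has_integral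
           M k a - 4 * M k (a + 1)) {0..1}"
    using Suc.IH[of a] Suc.IH[of "a + 1"] Suc.prems unfolding M_def
    by (intro has_integral_diff has_integral_mult_right) auto
  also have "M k a - 4 * M k (a + 1) = M (Suc k) a"
  proof -
    define p h g q where "p = 2 powr (- 2*a - 1)" and "h = Gamma (real k + 1/2)"
      and "g = Gamma (a + 1)" and "q = Gamma (real k + a + 3/2)"
    have q: "q > 0" "real k + a + 3/2 > 0" unfolding q_def using Suc.prems by auto
    have shift: "real (Suc k) + 1/2 = real k + 1/2 + 1" "real (Suc k) + a + 3/2 = real k + a + 3/2 + 1"
      "real k + (a + 1) + 3/2 = real k + a + 3/2 + 1" by simp_all
    have "p = 2 powr (2 + (- 2*(a + 1) - 1))"
      unfolding p_def by (rule arg_cong[where f = "\<lambda>e. 2 powr e"]) simp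
    hence quarter: "2 powr (- 2*(a + 1) - 1) = p / 4"
      unfolding powr_add by simp
    have step: "Gamma (a + 1 + 1) = (a + 1) * g" "Gamma (real k + 1/2 + 1) = (real k + 1/2) * h"
      "Gamma (real k + a + 3/2 + 1) = (real k + a + 3/2) * q"
      unfolding g_def h_def q_def using Suc.prems by (intro Gamma_plus1_pos; simp)+
    have "M k (a + 1) = p / 4 * h * ((a + 1) * g) / ((real k + a + 3/2) * q)"
      unfolding M_def shift step quarter by (simp add: h_def)
    moreover have "M (Suc k) a = p * ((real k + 1/2) * h) * g / ((real k + a + 3/2) * q)"
      unfolding M_def shift step by (simp add: p_def g_def)
    moreover have "M k a = p * h * g * (real k + a + 3/2) / ((real k + a + 3/2) * q)"
      unfolding M_def p_def h_def g_def q_def using q by simp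
    moreover have "p * h * g * (real k + a + 3/2) - 4 * (p / 4 * h * ((a + 1) * g)) = p * ((real k + 1/2) * h) * g"
      by algebra
    ultimately show ?thesis
      by (metis diff_divide_distrib times_divide_eq_right)
  qed
  finally have "((\<lambda>y. (1 - 2*y) ^ (2*k) * (y powr a * (1 - y) powr a)
             - 4 * ((1 - 2*y) ^ (2*k) * (y powr (a + 1) * (1 - y) powr (a + 1)))) has_integral
           M (Suc k) a) {0..1}" .
  moreover have "(1 - 2*y) ^ (2*k) * (y powr a * (1 - y) powr a)
             - 4 * ((1 - 2*y) ^ (2*k) * (y powr (a + 1) * (1 - y) powr (a + 1))) =
             (1 - 2*y) ^ (2*Suc k) * (y powr a * (1 - y) powr a)" if "y \<in> {0..1}" for y :: real
    using that by (subst symmetric_beta_weight_plus1) (auto simp: algebra_simps power2_eq_square)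
  ultimately have "((\<lambda>y. (1 - 2*y) ^ (2*Suc k) * (y powr a * (1 - y) powr a)) has_integral
           M (Suc k) a) {0..1}"
    by (subst has_integral_cong[symmetric]) auto
  thus ?case unfolding M_def .
qed

text \<open>These vanish because the weight is symmetric about \<open>1/2\<close>. In place of a reflection, the induction of
  the even case is used, starting from \<open>Beta (a + 2) (a + 1) = Beta (a + 1) (a + 1) / 2\<close>.\<close>
lemma has_integral_odd_moment:
  fixes a :: real
  assumes "a > -1"
  shows "((\<lambda>y. (1 - 2*y) ^ (2*k + 1) * (y powr a * (1 - y) powr a)) has_integral 0) {0..1}"
  using assms
proof (induction k arbitrary: a)
  case 0
  have "(a + 1 + (a + 1)) * Beta (a + 1 + 1) (a + 1) = (a + 1) * Beta (a + 1) (a + 1)"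
    using 0 by (intro Beta_plus1_left) (auto elim!: nonpos_Ints_cases)
  hence "(a + 1) * (Beta (a + 1) (a + 1) - 2 * Beta (a + 2) (a + 1)) = 0"
    by (simp add: algebra_simps)
  hence B: "Beta (a + 1) (a + 1) - 2 * Beta (a + 2) (a + 1) = 0"
    using 0 by simp
  have "((\<lambda>y. y powr a * (1 - y) powr a - 2 * (y powr (a + 1) * (1 - y) powr a)) has_integral
          (Beta (a + 1) (a + 1) - 2 * Beta (a + 2) (a + 1))) {0..1}"
    using has_integral_Beta_real[of "a + 1" "a + 1"] has_integral_Beta_real[of "a + 2" "a + 1"] 0
    by (intro has_integral_diff has_integral_mult_right) (auto simp: algebra_simps)
  thus ?case unfolding B
    by (subst (asm) has_integral_cong[where g = "\<lambda>y. (1 - 2*y) ^ (2*0 + 1) * (y powr a * (1 - y) powr a)"])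
       (auto simp: powr_add algebra_simps)
next
  case (Suc k)
  have "((\<lambda>y. (1 - 2*y) ^ (2*k + 1) * (y powr a * (1 - y) powr a)
             - 4 * ((1 - 2*y) ^ (2*k + 1) * (y powr (a + 1) * (1 - y) powr (a + 1)))) has_integral
           0 - 4 * 0) {0..1}"
    using Suc.IH[of a] Suc.IH[of "a + 1"] Suc.prems
    by (intro has_integral_diff has_integral_mult_right) auto
  moreover have "(1 - 2*y) ^ (2*k + 1) * (y powr a * (1 - y) powr a)
             - 4 * ((1 - 2*y) ^ (2*k + 1) * (y powr (a + 1) * (1 - y) powr (a + 1))) =
             (1 - 2*y) ^ (2*Suc k + 1) * (y powr a * (1 - y) powr a)" if "y \<in> {0..1}" for y :: real
    using that by (subst symmetric_beta_weight_plus1) (auto simp: algebra_simps power2_eq_square)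
  ultimately show ?case
    by (subst has_integral_cong[symmetric]) auto
qed

lemma abs_exp_partial_sum_le:
  fixes t :: real
  shows "\<bar>\<Sum>n<N. t ^ n / fact n\<bar> \<le> exp \<bar>t\<bar>"
proof -
  have "\<bar>\<Sum>n<N. t ^ n / fact n\<bar> \<le> (\<Sum>n<N. \<bar>t\<bar> ^ n / fact n)"
    by (rule order_trans[OF sum_abs]) (simp add: power_abs)
  also have "\<dots> \<le> (\<Sum>n. \<bar>t\<bar> ^ n / fact n)"
    using summable_exp[of "\<bar>t\<bar>"] by (intro sum_le_suminf) (auto simp: field_simps)
  also have "\<dots> = exp \<bar>t\<bar>"
    by (simp add: exp_def scaleR_conv_of_real field_simps)
  finally show ?thesis .
qed

text \<open>Only the partial sums of even length are taken, so that each step adds one even and one odd moment.\<close>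
lemma exp_partial_sum_tendsto:
  fixes t :: real
  shows "(\<lambda>N. \<Sum>n<2*N. t ^ n / fact n) \<longlonglongrightarrow> exp t"
proof -
  have "(\<lambda>N. \<Sum>n<N. t ^ n / fact n) \<longlonglongrightarrow> exp t"
    using exp_converges[of t] by (simp add: sums_def field_simps)
  moreover have "strict_mono (\<lambda>N::nat. 2 * N)" by (auto simp: strict_mono_def)
  ultimately show ?thesis using LIMSEQ_subseq_LIMSEQ by (fastforce simp: o_def)
qed

text \<open>The duplication formula at \<open>k + 1/2\<close> cancels the factorial of \<open>2*k\<close>, so the \<open>k\<close>-th
  even Taylor term of the exponential integrates to a fixed multiple of the \<open>k\<close>-th term of the Bessel series.\<close>
lemma bessel_I_term_eq_moment:
  fixes a x :: real
  assumes "a > -1" "x > 0"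
  shows "x ^ (2*k) / fact (2*k) *
           (2 powr (- 2*a - 1) * Gamma (real k + 1/2) * Gamma (a + 1) / Gamma (real k + a + 3/2)) =
         2 powr (- 2*a - 1) * sqrt pi * Gamma (a + 1) * (x/2) powr (- (a + 1/2)) *
           ((x / 2) powr (a + 1/2 + 2 * real k) / (Gamma (real k + 1) * Gamma (real k + (a + 1/2) + 1)))"
proof -
  have "Gamma (real k + 1/2) * Gamma (real k + 1) = 2 powr (- 2 * real k) * sqrt pi * Gamma (2 * real k + 1)"
    using Gamma_legendre_duplication_real[of "real k + 1/2"] by (simp add: algebra_simps)
  moreover have "Gamma (2 * real k + 1) = fact (2*k)" "Gamma (real k + 1) = fact k"
    using Gamma_fact[of "2*k", where 'a = real] Gamma_fact[of k, where 'a = real] by (simp_all add: add_ac)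
  ultimately have G: "Gamma (real k + 1/2) = 2 powr (- 2 * real k) * sqrt pi * fact (2*k) / fact k"
    by (simp add: field_simps)
  have "(x/2) powr (- (a + 1/2)) * (x / 2) powr (a + 1/2 + 2 * real k) = (x/2) powr (real (2*k))"
    unfolding powr_add[symmetric] by simp
  also have "\<dots> = (x/2) ^ (2*k)" using assms(2) by (subst powr_realpow) auto
  also have "\<dots> = x ^ (2*k) * 2 powr (- 2 * real k)"
    using powr_realpow[of 2 "2*k"] by (simp add: power_divide powr_minus field_simps)
  finally have P: "(x/2) powr (- (a + 1/2)) * (x / 2) powr (a + 1/2 + 2 * real k) =
     x ^ (2*k) * 2 powr (- 2 * real k)" .
  define p u v where "p = 2 powr (- 2*a - 1)" and "u = (x/2) powr (- (a + 1/2))"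
    and "v = (x / 2) powr (a + 1/2 + 2 * real k)"
  have shift: "real k + (a + 1/2) + 1 = real k + a + 3/2" by simp
  have "x ^ (2*k) / fact (2*k) * (p * Gamma (real k + 1/2) * Gamma (a + 1) / Gamma (real k + a + 3/2)) =
          p * sqrt pi * Gamma (a + 1) * (x ^ (2*k) * 2 powr (- 2 * real k)) / (fact k * Gamma (real k + a + 3/2))"
    unfolding G by simp
  also have "\<dots> = p * sqrt pi * Gamma (a + 1) * u * (v / (fact k * Gamma (real k + a + 3/2)))"
    unfolding P[folded u_def v_def, symmetric] by simp
  finally show ?thesis
    unfolding shift p_def u_def v_def \<open>Gamma (real k + 1) = fact k\<close> .
qed

text \<open>The exponential series is integrated term by term against the Beta weight; only the even terms
  survive, and they add up to the Bessel series. The interchange is dominated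
  by \<open>e\<^sup>x\<close> times the weight, which is integrable although it may be unbounded.\<close>
lemma bessel_I_poisson_integral:
  fixes a x :: real
  assumes a: "a > -1" and x: "x > 0"
  shows "((\<lambda>y. y powr a * (1 - y) powr a * exp (x * (1 - 2*y))) has_integral
           (2 powr (- 2*a - 1) * sqrt pi * Gamma (a + 1) * (x/2) powr (- (a + 1/2)) * bessel_I (a + 1/2) x)) {0..1}"
proof -
  define w where "w = (\<lambda>y::real. y powr a * (1 - y) powr a)"
  define f where "f = (\<lambda>N y. w y * (\<Sum>n<2*N. (x * (1 - 2*y)) ^ n / fact n))"
  define g where "g = (\<lambda>y. w y * exp (x * (1 - 2*y)))"
  define C where "C = 2 powr (- 2*a - 1) * sqrt pi * Gamma (a + 1) * (x/2) powr (- (a + 1/2))"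
  define B where "B = (\<lambda>k. (x / 2) powr (a + 1/2 + 2 * real k) /
                             (Gamma (real k + 1) * Gamma (real k + (a + 1/2) + 1)))"
  have C: "C > 0" unfolding C_def using a x by (auto intro!: mult_pos_pos)
  have w0: "w y \<ge> 0" for y unfolding w_def by simp
  have hf: "(f N has_integral (\<Sum>k<N. C * B k)) {0..1}" for N
  proof (induction N)
    case 0
    show ?case by (simp add: f_def)
  next
    case (Suc N)
    have "C * B N = x ^ (2*N) / fact (2*N) * (2 powr (- 2*a - 1) * Gamma (real N + 1/2) * Gamma (a + 1) /
            Gamma (real N + a + 3/2))"
      unfolding C_def B_def using bessel_I_term_eq_moment[OF a x, of N] by simp
    hence even: "((\<lambda>y. x ^ (2*N) / fact (2*N) * ((1 - 2*y) ^ (2*N) * w y)) has_integral C * B N) {0..1}"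
      unfolding w_def by (simp only: has_integral_mult_right[OF has_integral_even_moment[OF a, of N]])
    have odd: "((\<lambda>y. x ^ (2*N+1) / fact (2*N+1) * ((1 - 2*y) ^ (2*N+1) * w y)) has_integral
                 x ^ (2*N+1) / fact (2*N+1) * 0) {0..1}"
      unfolding w_def by (rule has_integral_mult_right[OF has_integral_odd_moment[OF a, of N]])
    have "f (Suc N) y = f N y + (x ^ (2*N) / fact (2*N) * ((1 - 2*y) ^ (2*N) * w y) +
            x ^ (2*N+1) / fact (2*N+1) * ((1 - 2*y) ^ (2*N+1) * w y))" for y
    proof -
      have "f (Suc N) y = w y * ((\<Sum>n<2*N. (x * (1 - 2*y)) ^ n / fact n)
              + (x * (1 - 2*y)) ^ (2*N) / fact (2*N) + (x * (1 - 2*y)) ^ (2*N+1) / fact (2*N+1))"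
        by (simp add: f_def del: fact_Suc power_Suc)
      thus ?thesis unfolding f_def power_mult_distrib by (simp add: distrib_left mult_ac del: fact_Suc power_Suc)
    qed
    hence "f (Suc N) = (\<lambda>y. f N y + (x ^ (2*N) / fact (2*N) * ((1 - 2*y) ^ (2*N) * w y) +
            x ^ (2*N+1) / fact (2*N+1) * ((1 - 2*y) ^ (2*N+1) * w y)))" by blast
    moreover have "(\<Sum>k<Suc N. C * B k) =
        (\<Sum>k<N. C * B k) + (C * B N + x ^ (2*N+1) / fact (2*N+1) * 0)" by simp
    ultimately show ?case
      using has_integral_add[OF Suc.IH has_integral_add[OF even odd]] by (simp only:)
  qed
  have le: "norm (f N y) \<le> exp x * w y" if "y \<in> {0..1}" for N y
  proof -
    have "\<bar>x * (1 - 2*y)\<bar> \<le> x * 1"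
      unfolding abs_mult using that x by (intro mult_mono) auto
    hence "exp \<bar>x * (1 - 2*y)\<bar> \<le> exp x" by simp
    hence "\<bar>\<Sum>n<2*N. (x * (1 - 2*y)) ^ n / fact n\<bar> \<le> exp x"
      using abs_exp_partial_sum_le[of "x * (1 - 2*y)" "2*N"] by linarith
    hence "w y * \<bar>\<Sum>n<2*N. (x * (1 - 2*y)) ^ n / fact n\<bar> \<le> w y * exp x"
      using w0 by (rule mult_left_mono)
    thus ?thesis unfolding f_def using w0[of y] by (simp only: real_norm_def abs_mult abs_of_nonneg mult.commute)
  qed
  have h: "(\<lambda>y. exp x * w y) integrable_on {0..1}"
    using has_integral_even_moment[OF a, of 0] unfolding w_def
    by (intro integrable_on_mult_right) (auto simp: integrable_on_def)
  have lim: "(\<lambda>N. f N y) \<longlonglongrightarrow> g y" for y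
    unfolding f_def g_def by (intro tendsto_intros exp_partial_sum_tendsto)
  note dc = dominated_convergence[of f "{0..1}" "\<lambda>y. exp x * w y" g, OF _ h le lim]
  have int: "integral {0..1} (f N) = (\<Sum>k<N. C * B k)" for N
    using hf by (rule integral_unique)
  have "(\<lambda>k. C * B k) sums integral {0..1} g"
    using dc(2) hf unfolding sums_def int by blast
  hence "B sums (integral {0..1} g / C)"
    using C sums_mult_D[of C B "integral {0..1} g"] by simp
  hence "bessel_I (a + 1/2) x = integral {0..1} g / C"
    unfolding bessel_I_def B_def by (rule sums_unique[symmetric])
  hence "integral {0..1} g = C * bessel_I (a + 1/2) x" using C by simp
  moreover have "g integrable_on {0..1}" using dc(1) hf by blast
  ultimately have "(g has_integral C * bessel_I (a + 1/2) x) {0..1}"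
    by (metis integrable_integral)
  thus ?thesis unfolding g_def C_def w_def .
qed

definition bessel_ratio :: "real \<Rightarrow> real \<Rightarrow> real" where
  "bessel_ratio \<nu> x = bessel_I \<nu> x / (exp x / sqrt (2 * pi * x))"

text \<open>Poisson's integral under the substitution \<open>y = s / L\<close> with \<open>L = 2 * x\<close>. All powers of \<open>x\<close> and \<open>2\<close> cancel
  against the leading asymptotic term. The integrand is extended by zero beyond \<open>L\<close>, so that it can be compared with Gamma
  integrands on the same half-line.\<close>
lemma bessel_ratio_integral:
  fixes a L :: real
  assumes a: "a > -1" and L: "L > 0"
  shows "((\<lambda>s. if s \<le> L then s powr a * (1 - s/L) powr a * exp (-s) else 0) has_integral
           (Gamma (a + 1) * bessel_ratio (a + 1/2) (L/2))) {0..}"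
proof -
  define x where "x = L / 2"
  have x: "x > 0" "L = 2 * x" using L by (auto simp: x_def)
  define J where "J = 2 powr (- 2*a - 1) * sqrt pi * Gamma (a + 1) * (x/2) powr (- (a + 1/2)) * bessel_I (a + 1/2) x"
  have "((\<lambda>y. y powr a * (1 - y) powr a * exp (x * (1 - 2*y))) has_integral J) (cbox 0 1)"
    using bessel_I_poisson_integral[OF a x(1)] by (simp add: J_def)
  from has_integral_affinity'[OF this, of "1/L" 0]
  have "((\<lambda>s. (s/L) powr a * (1 - s/L) powr a * exp (x * (1 - 2*(s/L)))) has_integral (L * J)) {0..L}"
    using L by (simp add: field_simps)
  hence "((\<lambda>s. L powr a * exp (-x) * ((s/L) powr a * (1 - s/L) powr a * exp (x * (1 - 2*(s/L))))) has_integral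
           (L powr a * exp (-x) * (L * J))) {0..L}"
    by (rule has_integral_mult_right)
  also have "L powr a * exp (-x) * (L * J) = Gamma (a + 1) * bessel_ratio (a + 1/2) (L/2)"
  proof -
    have "L powr a * L * 2 powr (- 2*a - 1) * (x/2) powr (- (a + 1/2)) =
            (2 powr a * x powr a * 2 powr 1 * x powr 1) * 2 powr (- 2*a - 1) *
              (x powr (- (a + 1/2)) * 2 powr (a + 1/2))"
      using x by (simp add: powr_mult powr_divide powr_minus field_simps)
    also have "\<dots> = 2 powr (a + 1 + (- 2*a - 1) + (a + 1/2)) * x powr (a + 1 + (- (a + 1/2)))"
      unfolding powr_add by simp
    also have "\<dots> = 2 powr (1/2) * x powr (1/2)" by simp
    also have "\<dots> = sqrt 2 * sqrt x" using x by (simp add: powr_half_sqrt)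
    finally have E: "L powr a * L * 2 powr (- 2*a - 1) * (x/2) powr (- (a + 1/2)) = sqrt 2 * sqrt x" .
    have half: "L / 2 = x" by (simp add: x_def)
    have "L powr a * exp (-x) * (L * J) = (L powr a * L * 2 powr (- 2*a - 1) * (x/2) powr (- (a + 1/2))) *
        (exp (-x) * sqrt pi * Gamma (a + 1) * bessel_I (a + 1/2) x)"
      unfolding J_def by simp
    also have "\<dots> = Gamma (a + 1) * bessel_ratio (a + 1/2) (L/2)"
      unfolding E bessel_ratio_def half real_sqrt_mult exp_minus by (simp add: field_simps)
    finally show ?thesis .
  qed
  finally have I: "((\<lambda>s. L powr a * exp (-x) * ((s/L) powr a * (1 - s/L) powr a * exp (x * (1 - 2*(s/L))))) has_integral
           (Gamma (a + 1) * bessel_ratio (a + 1/2) (L/2))) {0..L}" .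
  have "((\<lambda>s. if s \<in> {0..L} then s powr a * (1 - s/L) powr a * exp (-s) else 0) has_integral
           (Gamma (a + 1) * bessel_ratio (a + 1/2) (L/2))) {0..L}"
  proof (rule has_integral_eq[OF _ I])
    fix s assume s: "s \<in> {0..L}"
    have "exp (-x) * exp (x * (1 - 2*(s/L))) = exp (-s)"
      unfolding exp_add[symmetric] using x by (simp add: field_simps)
    moreover have "L powr a * (s/L) powr a = s powr a" 
      using s L by (simp add: powr_divide)
    moreover have "L powr a * exp (-x) * ((s/L) powr a * (1 - s/L) powr a * exp (x * (1 - 2*(s/L)))) =
      (L powr a * (s/L) powr a) * (1 - s/L) powr a * (exp (-x) * exp (x * (1 - 2*(s/L))))" by simp
    ultimately show "L powr a * exp (-x) * ((s/L) powr a * (1 - s/L) powr a * exp (x * (1 - 2*(s/L)))) =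
      (if s \<in> {0..L} then s powr a * (1 - s/L) powr a * exp (-s) else 0)" using s by simp
  qed
  hence "((\<lambda>s. if s \<in> {0..L} then s powr a * (1 - s/L) powr a * exp (-s) else 0) has_integral
           (Gamma (a + 1) * bessel_ratio (a + 1/2) (L/2))) {0..}"
    by (rule has_integral_on_superset) auto
  thus ?thesis
    by (rule has_integral_eq[rotated]) auto
qed

section \<open>Elementary inequalities for powers\<close>

lemma exp_1_ge: "exp 1 \<ge> (2718/1000 :: real)"
proof -
  have "(\<Sum>n<7. 1 ^ n / fact n :: real) \<le> (\<Sum>n. 1 ^ n / fact n)"
    using summable_exp[of "1::real"] by (intro sum_le_suminf) (auto simp: field_simps)
  also have "\<dots> = exp 1" by (simp add: exp_def scaleR_conv_of_real field_simps)
  finally show ?thesis by (simp add: eval_nat_numeral)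
qed

text \<open>The maximum is at \<open>s = n\<close>; it follows from \<open>e\<^sup>t \<ge> 1 + t\<close> at \<open>t = s/n - 1\<close>.\<close>
lemma power_times_exp_minus_le:
  fixes s :: real
  assumes "s \<ge> 0" "n > 0"
  shows "s ^ n * exp (-s) \<le> (real n / exp 1) ^ n"
proof -
  have "s / n \<le> exp (s / n - 1)" using exp_ge_add_one_self[of "s / n - 1"] by simp
  hence "(s / n) ^ n \<le> exp (s / n - 1) ^ n" using assms by (intro power_mono) auto
  also have "\<dots> = exp s / exp 1 ^ n"
    using assms by (simp add: exp_of_nat_mult[symmetric] exp_diff[symmetric] field_simps)
  finally show ?thesis using assms by (simp add: power_divide exp_minus field_simps)
qed

lemma power2_times_exp_minus_le: "s \<ge> 0 \<Longrightarrow> s ^ 2 * exp (-s) \<le> (55/100 :: real)"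
  and power3_times_exp_minus_le: "s \<ge> 0 \<Longrightarrow> s ^ 3 * exp (-s) \<le> (135/100 :: real)"
  and power4_times_exp_minus_le: "s \<ge> 0 \<Longrightarrow> s ^ 4 * exp (-s) \<le> (470/100 :: real)"
proof -
  have e: "(real n / exp 1) ^ n \<le> (real n / (2718/1000)) ^ n" for n
    using exp_1_ge by (intro power_mono divide_left_mono) auto
  show "s ^ 2 * exp (-s) \<le> 55/100" if "s \<ge> 0"
    using power_times_exp_minus_le[OF that, of 2] e[of 2] by (simp add: power_divide)
  show "s ^ 3 * exp (-s) \<le> 135/100" if "s \<ge> 0"
    using power_times_exp_minus_le[OF that, of 3] e[of 3] by (simp add: power_divide)
  show "s ^ 4 * exp (-s) \<le> 470/100" if "s \<ge> 0"
    using power_times_exp_minus_le[OF that, of 4] e[of 4] by (simp add: power_divide)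
qed

text \<open>Young's inequality with one factor equal to 1. For \<open>w = 1 - y\<close> this is Bernoulli's inequality with an exponent in the unit interval.\<close>
lemma powr_le_weighted_mean:
  fixes w :: real
  assumes "w \<ge> 0" "0 \<le> \<theta>" "\<theta> \<le> 1"
  shows "w powr \<theta> \<le> 1 - \<theta> + \<theta> * w"
  using Youngs_inequality_0[of "1 - \<theta>" \<theta> 1 w] assms by (cases "w = 0") auto

text \<open>The previous inequality with exponent \<open>1/a\<close>, applied to \<open>(1 - y)\<^sup>a\<close>.\<close>
lemma bernoulli_powr_ge1:
  fixes y :: real
  assumes "y \<le> 1" "1 \<le> a"
  shows "1 - a * y \<le> (1 - y) powr a"
proof -
  have "((1 - y) powr a) powr (1/a) \<le> 1 - 1/a + 1/a * (1 - y) powr a"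
    using assms by (intro powr_le_weighted_mean) auto
  also have "((1 - y) powr a) powr (1/a) = 1 - y" using assms by (simp add: powr_powr)
  finally have "a * (1 - y) \<le> a * (1 - 1/a + 1/a * (1 - y) powr a)"
    using assms by (intro mult_left_mono) auto
  also have "\<dots> = a - 1 + (1 - y) powr a" using assms by (simp add: field_simps)
  finally show ?thesis by (simp add: algebra_simps)
qed

lemma bernoulli_powr_minus:
  fixes y :: real
  assumes "y < 1" "0 \<le> c"
  shows "1 + c * y \<le> (1 - y) powr (-c)"
proof -
  have "ln (1 - y) \<le> - y" using ln_le_minus_one[of "1 - y"] assms by simp
  hence "c * y \<le> - c * ln (1 - y)" using assms by (metis minus_mult_left minus_mult_right mult_left_mono minus_minus neg_le_iff_le)
  also have "1 + (- c * ln (1 - y)) \<le> exp (- c * ln (1 - y))" by (rule exp_ge_add_one_self)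
  finally show ?thesis using assms by (simp add: powr_def)
qed

text \<open>All Taylor coefficients of \<open>(1 - y)\<^sup>a\<close> after the first are nonpositive for \<open>0 \<le> a \<le> 1\<close>, so a Taylor polynomial lies above the function.\<close>
lemma one_minus_powr_le_quadratic:
  fixes y :: real
  assumes "0 \<le> y" "y < 1" "0 \<le> a" "a \<le> 1"
  shows "(1 - y) powr a \<le> 1 - a * y - a * (1 - a) / 2 * y\<^sup>2"
proof -
  define E where "E = (\<lambda>t. 1 - a * t - a * (1 - a) / 2 * t\<^sup>2 - (1 - t) powr a)"
  have "E 0 \<le> E y"
  proof (rule DERIV_nonneg_imp_nondecreasing[OF assms(1)])
    fix t assume t: "0 \<le> t" "t \<le> y"
    have "(E has_field_derivative (- a - a * (1 - a) * t + a * (1 - t) powr (a - 1))) (at t)"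
      unfolding E_def using t assms by (auto intro!: derivative_eq_intros simp: field_simps)
    moreover have "a * (1 + (1 - a) * t) \<le> a * (1 - t) powr (a - 1)"
      using bernoulli_powr_minus[of t "1 - a"] t assms by (intro mult_left_mono) auto
    ultimately show "\<exists>D. (E has_field_derivative D) (at t) \<and> 0 \<le> D"
      by (intro exI conjI) (assumption, simp add: algebra_simps)
  qed
  thus ?thesis by (simp add: E_def)
qed

text \<open>The third order remainder of \<open>(1 - y)\<^sup>a\<close>. The quadratic upper bound of the function bounds its derivative, divided by \<open>-a\<close>,
  by the sum of the linear Taylor polynomial \<open>1 + (1 - a) * y\<close> and \<open>(1 - a) * (1 - a/2) * y\<^sup>2 / (1 - y)\<close>. Integrating the last expression exactly would give a logarithm; the
  majorant \<open>y\<^sup>3 / sqrt (1 - y)\<close> has a simple integral over the unit interval instead. With \<open>u = sqrt (1 - y)\<close>, the factor \<open>9/20\<close> makes the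
  derivative of the majorant large enough, because \<open>9/8 * u\<^sup>2 - u + 9/40\<close> has no real root.\<close>
lemma one_minus_powr_ge_cubic:
  fixes y :: real
  assumes "0 \<le> y" "y < 1" "0 \<le> a" "a \<le> 1"
  shows "1 - a * y - a * (1 - a) / 2 * y\<^sup>2 - a * (1 - a) * (1 - a / 2) * (9 / 20) * (y ^ 3 / sqrt (1 - y))
           \<le> (1 - y) powr a"
proof -
  define c where "c = (1 - a) * (1 - a / 2)"
  define T where "T = (\<lambda>t::real. 9 / 20 * (t ^ 3 * (1 - t) powr (-1/2)))"
  define D where "D = (\<lambda>t. (1 - t) powr a - (1 - a * t - a * (1 - a) / 2 * t\<^sup>2 - a * c * T t))"
  have c: "c \<ge> 0" using assms by (simp add: c_def)
  have "D 0 \<le> D y"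
  proof (rule DERIV_nonneg_imp_nondecreasing[OF assms(1)])
    fix t assume t: "0 \<le> t" "t \<le> y"
    define u where "u = sqrt (1 - t)"
    have u: "0 < u" "u\<^sup>2 = 1 - t" using t assms by (auto simp: u_def)
    have u_powr: "(1 - t) powr (-1/2) = 1 / u" "(1 - t) powr (-3/2) = 1 / u ^ 3"
    proof -
      have "(1 - t) powr r = u powr (2 * r)" for r
        unfolding u(2)[symmetric] using u(1) powr_powr[of u 2 r] by simp
      note eq = this
      have "(1 - t) powr (-1/2) = u powr (-1)" "(1 - t) powr (-3/2) = u powr (-3)"
        by (subst eq, simp)+
      thus "(1 - t) powr (-1/2) = 1 / u" "(1 - t) powr (-3/2) = 1 / u ^ 3"
        using powr_neg_one[OF u(1)] powr_neg_numeral[OF u(1), of "num.Bit1 num.One"] by metis+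
    qed
    define T' where "T' = 9 / 20 * (3 * t\<^sup>2 * (1 / u) + t ^ 3 * (1/2 * (1 / u ^ 3)))"
    have dT: "(T has_field_derivative T') (at t)"
      unfolding T_def T'_def u_powr[symmetric] using t assms
      by (auto intro!: derivative_eq_intros)
    have "T' = t\<^sup>2 / u ^ 3 * (9/20 * (3 * u\<^sup>2 + t / 2))"
      unfolding T'_def using u(1) by (simp add: field_simps power2_eq_square power3_eq_cube)
    moreover have "t\<^sup>2 / (1 - t) = t\<^sup>2 / u ^ 3 * u"
      unfolding u(2)[symmetric] using u(1) by (simp add: power2_eq_square power3_eq_cube)
    moreover have "9/20 * (3 * u\<^sup>2 + t / 2) = u + (9/8 * (u - 4/9)\<^sup>2 + 1/360)"
      using u(2) by (simp add: power2_eq_square field_simps)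
    hence "u \<le> 9/20 * (3 * u\<^sup>2 + t / 2)"
      using zero_le_power2[of "u - 4/9"] by linarith
    hence "t\<^sup>2 / u ^ 3 * u \<le> t\<^sup>2 / u ^ 3 * (9/20 * (3 * u\<^sup>2 + t / 2))"
      using u(1) by (intro mult_left_mono) auto
    ultimately have T': "t\<^sup>2 / (1 - t) \<le> T'" by metis
    have "(1 - t) powr (a - 1) = (1 - t) powr a / (1 - t)" using t assms by (simp add: powr_diff)
    also have "\<dots> \<le> (1 - a * t - a * (1 - a) / 2 * t\<^sup>2) / (1 - t)"
      using one_minus_powr_le_quadratic[of t a] t assms by (intro divide_right_mono) auto
    also have "\<dots> = 1 + (1 - a) * t + c * (t\<^sup>2 / (1 - t))"
    proof -
      have "1 - a * t - a * (1 - a) / 2 * t\<^sup>2 = (1 + (1 - a) * t) * (1 - t) + c * t\<^sup>2"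
        unfolding c_def by algebra
      thus ?thesis using t assms by (simp add: add_divide_distrib)
    qed
    also have "\<dots> \<le> 1 + (1 - a) * t + c * T'" using mult_left_mono[OF T' c] by simp
    finally have "a * (1 - t) powr (a - 1) \<le> a * (1 + (1 - a) * t + c * T')"
      using assms by (intro mult_left_mono) auto
    moreover have "(D has_field_derivative (- (a * (1 - t) powr (a - 1)) + a + a * (1 - a) * t + a * c * T')) (at t)"
      unfolding D_def using t assms by (auto intro!: derivative_eq_intros dT simp: field_simps)
    ultimately show "\<exists>d. (D has_field_derivative d) (at t) \<and> 0 \<le> d"
      by (intro exI conjI) (assumption, simp add: algebra_simps)
  qed
  have sqrt: "(1 - y) powr (-1/2) = 1 / sqrt (1 - y)"
    using assms powr_minus_divide[of "1 - y" "1/2"] powr_half_sqrt[of "1 - y"] by simp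
  have "a * c * T y = a * (1 - a) * (1 - a / 2) * (9 / 20) * (y ^ 3 / sqrt (1 - y))"
    unfolding T_def c_def sqrt by simp
  moreover have "D 0 = 0" by (simp add: D_def T_def)
  ultimately show ?thesis using \<open>D 0 \<le> D y\<close> unfolding D_def by linarith
qed

text \<open>The remainder after the linear term, divided by its leading coefficient \<open>b * (1 + b) / 2\<close>, increases with \<open>b\<close>.
  It is therefore bounded by its value at \<open>b = 1/2\<close>, where it is algebraic and the leading coefficient is \<open>3/8\<close>; hence the factor \<open>4/3 * b * (1 + b)\<close>. On the level of derivatives this is the
  weighted mean inequality for the power \<open>(1 + b) / (3/2)\<close> of \<open>(1 - t)\<^bsup>-3/2\<^esup>\<close>.\<close>
lemma one_minus_powr_minus_le_chord:
  fixes y :: real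
  assumes "0 \<le> y" "y < 1" "0 \<le> b" "b \<le> 1/2"
  shows "(1 - y) powr (-b) \<le> 1 + b * y + 4/3 * b * (1 + b) * (1 / sqrt (1 - y) - 1 - y / 2)"
proof -
  define E where "E = (\<lambda>t. 1 + b * t + 4/3 * b * (1 + b) * ((1 - t) powr (-1/2) - 1 - t / 2) - (1 - t) powr (-b))"
  have "E 0 \<le> E y"
  proof (rule DERIV_nonneg_imp_nondecreasing[OF assms(1)])
    fix t assume t: "0 \<le> t" "t \<le> y"
    have "(E has_field_derivative (b + 4/3 * b * (1 + b) * (1/2 * (1 - t) powr (-3/2) - 1/2)
             - b * (1 - t) powr (-b - 1))) (at t)"
      unfolding E_def using t assms by (auto intro!: derivative_eq_intros simp: field_simps)
    note deriv = this
    have jensen: "((1 - t) powr (-3/2)) powr ((1 + b) / (3/2)) \<le>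
        1 - (1 + b) / (3/2) + (1 + b) / (3/2) * (1 - t) powr (-3/2)"
      using assms by (intro powr_le_weighted_mean) auto
    have exponent: "-3/2 * ((1 + b) / (3/2)) = - b - 1" by (simp add: field_simps)
    have "(1 - t) powr (-b - 1) \<le> 1 - (1 + b) / (3/2) + (1 + b) / (3/2) * (1 - t) powr (-3/2)"
      using jensen unfolding powr_powr exponent .
    hence "b * (1 - t) powr (-b - 1) \<le> b * (1 - (1 + b) / (3/2) + (1 + b) / (3/2) * (1 - t) powr (-3/2))"
      using assms by (intro mult_left_mono) auto
    with deriv show "\<exists>d. (E has_field_derivative d) (at t) \<and> 0 \<le> d"
      by (intro exI conjI) (assumption, simp add: field_simps)
  qed
  moreover have "(1 - y) powr (-1/2) = 1 / sqrt (1 - y)"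
    using assms powr_minus_divide[of "1 - y" "1/2"] powr_half_sqrt[of "1 - y"] by simp
  ultimately show ?thesis by (simp add: E_def)
qed

text \<open>With \<open>u = sqrt (1 - y)\<close> the difference of the two sides is a polynomial in \<open>u\<close> that vanishes to fourth order at \<open>u = 1\<close>.
  The constant \<open>11/16\<close> is the slope of the chord of the convex function \<open>(8 + 9 * u + 3 * u\<^sup>2) / (1 + u)\<^sup>3\<close> on the unit interval, divided by \<open>-8\<close>; a bound without it
  would be too large for the later estimate.\<close>
lemma inverse_sqrt_remainder_le:
  fixes y :: real
  assumes "0 \<le> y" "y < 1"
  shows "1 / sqrt (1 - y) - 1 - y / 2 \<le> 3/8 * y\<^sup>2 + y ^ 3 * (1 / sqrt (1 - y) - 11/16)"
proof -
  define u where "u = sqrt (1 - y)"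
  have u: "0 < u" "u \<le> 1" "y = 1 - u\<^sup>2" using assms by (auto simp: u_def)
  have "3/8 * y\<^sup>2 + y ^ 3 * (1 / u - 11/16) - (1 / u - 1 - y / 2)
          = 3/8 * y\<^sup>2 - 11/16 * y ^ 3 + 1 + y / 2 + (y ^ 3 - 1) / u"
    by (simp add: diff_divide_distrib right_diff_distrib)
  also have "(y ^ 3 - 1) = u * (- u * (3 - 3 * u\<^sup>2 + u ^ 4))"
    unfolding u(3) by (simp add: algebra_simps eval_nat_numeral)
  also have "\<dots> / u = - u * (3 - 3 * u\<^sup>2 + u ^ 4)" using u(1) by simp
  also have "3/8 * y\<^sup>2 - 11/16 * y ^ 3 + 1 + y / 2 + \<dots> =
               (1 - u) ^ 4 * (19 + 28 * u + 11 * u\<^sup>2) / 16"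
    unfolding u(3) by (simp add: field_simps eval_nat_numeral)
  also have "\<dots> \<ge> 0" using u by (intro divide_nonneg_pos mult_nonneg_nonneg add_nonneg_nonneg) auto
  finally show ?thesis by (simp add: u_def)
qed

lemma one_minus_powr_minus_le_cubic:
  fixes y :: real
  assumes "0 \<le> y" "y < 1" "0 \<le> b" "b \<le> 1/2"
  shows "(1 - y) powr (-b) \<le> 1 + b * y + b * (1 + b) / 2 * y\<^sup>2 +
           4/3 * b * (1 + b) * (y ^ 3 * (1 / sqrt (1 - y) - 11/16))"
proof -
  have "4/3 * b * (1 + b) * (1 / sqrt (1 - y) - 1 - y / 2) \<le>
        4/3 * b * (1 + b) * (3/8 * y\<^sup>2 + y ^ 3 * (1 / sqrt (1 - y) - 11/16))"
    using assms inverse_sqrt_remainder_le[of y] by (intro mult_left_mono) auto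
  also have "4/3 * b * (1 + b) * (3/8 * y\<^sup>2 + z) = b * (1 + b) / 2 * y\<^sup>2 + 4/3 * b * (1 + b) * z" for z
    by (simp add: field_simps)
  finally show ?thesis using one_minus_powr_minus_le_chord[OF assms] by linarith
qed

section \<open>Gamma integrals and their bounds\<close>

text \<open>Since \<open>ln Gamma\<close> is convex, it lies above its secant through \<open>q\<close> and \<open>q + 1\<close> outside the interval between them, and the slope of this secant is \<open>ln q\<close>.
  For \<open>q = 1\<close> it gives \<open>Gamma z \<ge> 1\<close> for \<open>0 < z \<le> 1\<close> and for \<open>z \<ge> 2\<close>.\<close>
lemma Gamma_ge_secant:
  fixes q z :: real
  assumes q: "q > 0" and z: "z > 0" and outside: "z \<le> q \<or> q + 1 \<le> z"
  shows "Gamma q * q powr (z - q) \<le> Gamma z"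
proof -
  define f where "f = (\<lambda>x::real. ln (Gamma x))"
  have conv: "f ((1 - t) * x + t * y) \<le> (1 - t) * f x + t * f y"
    if "0 \<le> t" "t \<le> 1" "x > 0" "y > 0" for t x y
    using convex_onD[OF log_convex_Gamma_real, of t x y] that by (simp add: f_def)
  have "Gamma q \<noteq> 0" using Gamma_real_pos[OF q] by linarith
  hence step: "f (q + 1) = f q + ln q"
    unfolding f_def Gamma_plus1_pos[OF q] using q by (simp add: ln_mult)
  have "f q + (z - q) * ln q \<le> f z"
    using outside
  proof
    assume "z \<le> q"
    define d where "d = q + 1 - z"
    have d: "d \<ge> 1" "z = q + 1 - d" using \<open>z \<le> q\<close> by (auto simp: d_def)
    have "(1 - 1/d) * (q + 1) + 1/d * z = q" using d(1) unfolding d(2) by (simp add: field_simps)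
    hence "f q \<le> (1 - 1/d) * f (q + 1) + 1/d * f z"
      using conv[of "1/d" "q + 1" z] d(1) q z by simp
    hence "d * f q \<le> (d - 1) * f (q + 1) + f z"
      using d(1) by (simp add: field_simps)
    thus ?thesis unfolding step d(2) by (simp add: algebra_simps)
  next
    assume "q + 1 \<le> z"
    define d where "d = z - q"
    have d: "d \<ge> 1" "z = q + d" using \<open>q + 1 \<le> z\<close> by (auto simp: d_def)
    have "(1 - 1/d) * q + 1/d * z = q + 1" using d(1) unfolding d(2) by (simp add: field_simps)
    hence "f (q + 1) \<le> (1 - 1/d) * f q + 1/d * f z"
      using conv[of "1/d" q z] d(1) q z by simp
    hence "d * f (q + 1) \<le> (d - 1) * f q + f z"
      using d(1) by (simp add: field_simps)
    thus ?thesis unfolding step d(2) by (simp add: algebra_simps)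
  qed
  hence "exp (f q + (z - q) * ln q) \<le> exp (f z)" by simp
  thus ?thesis using q z by (simp add: f_def exp_add powr_def)
qed

lemma has_integral_Gamma_powr:
  fixes p :: real
  assumes "p > -1"
  shows "((\<lambda>s. s powr p * exp (-s)) has_integral Gamma (p + 1)) {0..}"
  using Gamma_integral_real[of "p + 1"] assms by (simp add: exp_minus divide_inverse)

lemma has_integral_exp_tail:
  fixes L :: real
  assumes "L > 0"
  shows "((\<lambda>s. if L \<le> s then exp (-s) else 0) has_integral exp (-L)) {0..}"
proof -
  have "((\<lambda>s. exp (-s)) has_integral exp (-L)) {L..}"
    using has_integral_exp_minus_to_infinity[of 1 L] by simp
  hence "((\<lambda>s. if L \<le> s then exp (-s) else 0) has_integral exp (-L)) {L..}"
    by (rule has_integral_eq[rotated]) auto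
  thus ?thesis by (rule has_integral_on_superset) (use assms in auto)
qed

text \<open>An improper integral for the remainder terms; the constant \<open>c\<close> is \<open>0\<close> for positive \<open>a\<close> and \<open>11/16\<close> for negative \<open>a\<close>.\<close>
lemma has_integral_inverse_sqrt:
  fixes L c :: real
  assumes L: "L > 0"
  shows "((\<lambda>s. if s < L then 1 / sqrt (1 - s/L) - c else 0) has_integral (2 - c) * L) {0..}"
proof -
  define F where "F = (\<lambda>s. - 2 * L * sqrt (1 - s/L) - c * s)"
  have "((\<lambda>s. if s < L then 1 / sqrt (1 - s/L) - c else 0) has_integral (F L - F 0)) {0..L}"
  proof (rule fundamental_theorem_of_calculus_interior)
    show "continuous_on {0..L} F" unfolding F_def by (intro continuous_intros) (use L in auto)
    fix s assume s: "s \<in> {0<..<L}"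
    hence pos: "1 - s/L > 0" using L by simp
    have "((\<lambda>s. 1 - s/L) has_real_derivative (- 1/L)) (at s)"
      using L by (auto intro!: derivative_eq_intros)
    note DERIV_chain2[OF DERIV_real_sqrt[OF pos] this]
    from DERIV_diff[OF DERIV_cmult[OF this, of "- 2 * L"] DERIV_cmult[OF DERIV_ident, of c]]
    have "(F has_real_derivative (1 / sqrt (1 - s/L) - c)) (at s)"
      unfolding F_def using L by (simp add: inverse_eq_divide)
    thus "(F has_vector_derivative (if s < L then 1 / sqrt (1 - s/L) - c else 0)) (at s)"
      using s by (simp add: has_real_derivative_iff_has_vector_derivative)
  qed (use L in auto)
  also have "F L - F 0 = (2 - c) * L" using L by (simp add: F_def algebra_simps)
  finally have "((\<lambda>s. if s \<in> {0..L} then (if s < L then 1 / sqrt (1 - s/L) - c else 0) else 0)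
      has_integral (2 - c) * L) {0..L}"
    by (rule has_integral_eq[rotated]) auto
  hence "((\<lambda>s. if s \<in> {0..L} then (if s < L then 1 / sqrt (1 - s/L) - c else 0) else 0)
      has_integral (2 - c) * L) {0..}"
    by (rule has_integral_on_superset) auto
  thus ?thesis by (rule has_integral_eq[rotated]) auto
qed

section \<open>Two-sided bounds for the Bessel quotient\<close>

lemma bessel_ratio_le_1:
  assumes a: "a \<ge> 0" and L: "L > 0"
  shows "bessel_ratio (a + 1/2) (L/2) \<le> 1"
proof -
  have "Gamma (a + 1) * bessel_ratio (a + 1/2) (L/2) \<le> Gamma (a + 1)"
  proof (rule has_integral_le[OF bessel_ratio_integral has_integral_Gamma_powr])
    fix s :: real assume s: "s \<in> {0..}"
    have "s powr a * (1 - s/L) powr a * exp (-s) \<le> s powr a * 1 * exp (-s)" if "s \<le> L"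
      using that s L a by (intro mult_right_mono mult_left_mono powr_le1) auto
    thus "(if s \<le> L then s powr a * (1 - s/L) powr a * exp (-s) else 0) \<le> s powr a * exp (-s)" by auto
  qed (use a L in auto)
  moreover have "Gamma (a + 1) > 0" using a by simp
  ultimately show ?thesis by (simp add: mult_le_cancel_left1)
qed

text \<open>For \<open>a \<ge> 1\<close> the linear Taylor polynomial is nonpositive beyond \<open>L\<close>, so the cut-off costs nothing.\<close>
lemma bessel_ratio_ge_linear:
  assumes a: "a \<ge> 1" and L: "L > 0"
  shows "1 - a * (a + 1) / L \<le> bessel_ratio (a + 1/2) (L/2)"
proof -
  have "Gamma (a + 1) - a / L * Gamma (a + 1 + 1) \<le> Gamma (a + 1) * bessel_ratio (a + 1/2) (L/2)"
  proof (rule has_integral_le)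
    show "((\<lambda>s. s powr a * exp (-s) - a / L * (s powr (a + 1) * exp (-s))) has_integral
             (Gamma (a + 1) - a / L * Gamma (a + 1 + 1))) {0..}"
      using a by (intro has_integral_diff has_integral_mult_right has_integral_Gamma_powr) auto
    show "((\<lambda>s. if s \<le> L then s powr a * (1 - s/L) powr a * exp (-s) else 0) has_integral
             (Gamma (a + 1) * bessel_ratio (a + 1/2) (L/2))) {0..}"
      using a L by (intro bessel_ratio_integral) auto
    fix s :: real assume s: "s \<in> {0..}"
    have eq: "s powr a * exp (-s) - a / L * (s powr (a + 1) * exp (-s)) = s powr a * exp (-s) * (1 - a * (s/L))"
      using s by (simp add: powr_add algebra_simps)
    show "s powr a * exp (-s) - a / L * (s powr (a + 1) * exp (-s)) \<le>
            (if s \<le> L then s powr a * (1 - s/L) powr a * exp (-s) else 0)"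
    proof (cases "s \<le> L")
      case True
      have "s powr a * exp (-s) * (1 - a * (s/L)) \<le> s powr a * exp (-s) * (1 - s/L) powr a"
        using True L a by (intro mult_left_mono bernoulli_powr_ge1) auto
      thus ?thesis unfolding eq using True by (simp add: mult_ac)
    next
      case False
      hence "1 * 1 \<le> a * (s / L)" using L a by (intro mult_mono) auto
      thus ?thesis unfolding eq using False by (simp add: mult_nonneg_nonpos)
    qed
  qed
  also have "Gamma (a + 1) - a / L * Gamma (a + 1 + 1) = Gamma (a + 1) * (1 - a * (a + 1) / L)"
  proof -
    have "Gamma (a + 1 + 1) = (a + 1) * Gamma (a + 1)" using a by (intro Gamma_plus1_pos) auto
    thus ?thesis by (simp only:) (simp add: algebra_simps add_divide_distrib)
  qed
  finally show ?thesis using a by simp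
qed

text \<open>Beyond \<open>L\<close> the linear Taylor term overshoots, and this compensates most of the Gamma integrand there. The bound is pointwise, so that the tail
  contributes no more than \<open>(1 - a) * L\<^sup>a * e\<^sup>-\<^sup>L\<close> after integration. The factor \<open>1 - a\<close>
  is essential: as \<open>a\<close> tends to 1 the allowed second order term vanishes as well.\<close>
lemma powr_tail_le:
  fixes s L a :: real
  assumes "0 < L" "L \<le> s" "0 \<le> a" "a \<le> 1"
  shows "s powr a * (1 - a * (s/L)) \<le> (1 - a) * L powr a"
proof -
  define w where "w = s / L"
  have w: "w \<ge> 1" using assms by (simp add: w_def)
  have "w powr a * (1 - a * w) \<le> 1 - a"
  proof (cases "1 - a * w \<ge> 0")
    case True
    have "w powr a * (1 - a * w) \<le> (1 - a + a * w) * (1 - a * w)"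
      using True w assms by (intro mult_right_mono powr_le_weighted_mean) auto
    also have "\<dots> = 1 - a - a\<^sup>2 * w * (w - 1)" by algebra
    also have "\<dots> \<le> 1 - a" using w by simp
    finally show ?thesis .
  next
    case False
    hence "w powr a * (1 - a * w) \<le> 0" by (intro mult_nonneg_nonpos) auto
    thus ?thesis using assms by simp
  qed
  hence "L powr a * (w powr a * (1 - a * w)) \<le> L powr a * (1 - a)" by (intro mult_left_mono) auto
  moreover have "L powr a * w powr a = s powr a" using assms by (simp add: w_def powr_divide)
  ultimately have "s powr a * (1 - a * w) \<le> L powr a * (1 - a)" by (simp only: mult.assoc[symmetric])
  thus ?thesis by (simp only: w_def mult.commute[of "1 - a"])
qed

text \<open>Interpolation between the maxima of \<open>s\<^sup>3 * e\<^sup>-\<^sup>s\<close> and \<open>s\<^sup>4 * e\<^sup>-\<^sup>s\<close>.\<close>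
lemma powr_times_exp_minus_le_affine:
  fixes s a :: real
  assumes "0 \<le> s" "0 \<le> a" "a \<le> 1"
  shows "s powr a * s ^ 3 * exp (-s) \<le> 135/100 + 335/100 * a"
proof -
  have "s powr a * (s ^ 3 * exp (-s)) \<le> (1 - a + a * s) * (s ^ 3 * exp (-s))"
    using assms by (intro mult_right_mono powr_le_weighted_mean) auto
  also have "\<dots> = (1 - a) * (s ^ 3 * exp (-s)) + a * (s ^ 4 * exp (-s))"
    by (simp add: algebra_simps eval_nat_numeral)
  also have "\<dots> \<le> (1 - a) * (135/100) + a * (470/100)"
    using assms by (intro add_mono mult_left_mono power3_times_exp_minus_le power4_times_exp_minus_le) auto
  finally show ?thesis by (simp add: field_simps)
qed

text \<open>Both sides are multiplied by \<open>3\<^sup>b\<close>, which normalises the right-hand side: the secant bound at \<open>q = 3\<close> gives \<open>3\<^sup>b * Gamma (3 - b) \<ge> 2\<close>. On the left,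
  \<open>(3/s)\<^sup>b\<close> is at most \<open>1 - b + 3 * b / s\<close>. The factor \<open>6/7\<close> is what makes the cubic remainder for negative \<open>a\<close> three times
  as large as its quadratic Taylor term.\<close>
lemma powr_times_exp_minus_le_Gamma:
  fixes s b :: real
  assumes "0 \<le> s" "0 \<le> b" "b \<le> 1"
  shows "s powr (-b) * s ^ 3 * exp (-s) \<le> 6/7 * Gamma (3 - b)"
proof (cases "s = 0")
  case True
  thus ?thesis using assms by simp
next
  case False
  hence s: "s > 0" using assms by simp
  have "3 powr b * (s powr (-b) * s ^ 3 * exp (-s)) = (3 / s) powr b * (s ^ 3 * exp (-s))"
    using s by (simp add: powr_divide powr_minus field_simps)
  also have "\<dots> \<le> (1 - b + b * (3 / s)) * (s ^ 3 * exp (-s))"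
    using s assms by (intro mult_right_mono powr_le_weighted_mean) auto
  also have "\<dots> = (1 - b) * (s ^ 3 * exp (-s)) + 3 * b * (s ^ 2 * exp (-s))"
    using s by (simp add: field_simps eval_nat_numeral)
  also have "\<dots> \<le> (1 - b) * (135/100) + 3 * b * (55/100)"
    using assms by (intro add_mono mult_left_mono power3_times_exp_minus_le power2_times_exp_minus_le) auto
  also have "\<dots> \<le> 12/7" using assms by (simp add: field_simps)
  finally have A: "3 powr b * (s powr (-b) * s ^ 3 * exp (-s)) \<le> 12/7" .
  have "Gamma 3 * 3 powr (-b) \<le> Gamma (3 - b)"
    using Gamma_ge_secant[of 3 "3 - b"] assms by simp
  moreover have "Gamma 3 = (2::real)" using Gamma_numeral[of "num.Bit1 num.One", where 'a = real] by (simp add: fact_numeral)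
  ultimately have "2 \<le> 3 powr b * Gamma (3 - b)" by (simp add: powr_minus field_simps)
  with A have "3 powr b * (s powr (-b) * s ^ 3 * exp (-s)) \<le> 3 powr b * (6/7 * Gamma (3 - b))" by linarith
  thus ?thesis by (rule mult_left_le_imp_le) simp
qed

text \<open>The factor \<open>(1 - s/L)\<^sup>a\<close> is at least 1, so only the tail is lost. It is at most \<open>e\<^sup>-\<^sup>L\<close> because \<open>s\<^sup>a\<close> decreases from \<open>L\<^sup>a \<le> 1\<close>;
  the division by \<open>Gamma (a + 1) \<ge> 1\<close> does not increase it. The hypothesis on \<open>L\<close> also covers \<open>a = 0\<close> with arbitrarily small \<open>L\<close>.\<close>
lemma bessel_ratio_ge_minus_exp:
  assumes a: "-1 < a" "a \<le> 0" and L: "L > 0" "L powr a \<le> 1"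
  shows "1 - exp (-L) \<le> bessel_ratio (a + 1/2) (L/2)"
proof -
  have "Gamma (a + 1) - exp (-L) \<le> Gamma (a + 1) * bessel_ratio (a + 1/2) (L/2)"
  proof (rule has_integral_le)
    show "((\<lambda>s. s powr a * exp (-s) - (if L \<le> s then exp (-s) else 0)) has_integral
             (Gamma (a + 1) - exp (-L))) {0..}"
      using a L by (intro has_integral_diff has_integral_Gamma_powr has_integral_exp_tail) auto
    show "((\<lambda>s. if s \<le> L then s powr a * (1 - s/L) powr a * exp (-s) else 0) has_integral
             (Gamma (a + 1) * bessel_ratio (a + 1/2) (L/2))) {0..}"
      using a L by (intro bessel_ratio_integral) auto
    fix s :: real assume s: "s \<in> {0..}"
    show "s powr a * exp (-s) - (if L \<le> s then exp (-s) else 0) \<le>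
            (if s \<le> L then s powr a * (1 - s/L) powr a * exp (-s) else 0)"
    proof (cases "s < L")
      case True
      have "1 powr a \<le> (1 - s/L) powr a"
        using True s L a by (intro powr_mono2') auto
      hence "s powr a * exp (-s) * 1 \<le> s powr a * exp (-s) * (1 - s/L) powr a"
        by (intro mult_left_mono) auto
      thus ?thesis using True by (simp add: mult_ac)
    next
      case False
      hence "s powr a \<le> L powr a" using L a by (intro powr_mono2') auto
      hence "s powr a * exp (-s) \<le> 1 * exp (-s)" using L by (intro mult_right_mono) auto
      thus ?thesis using False L by (auto intro: order_trans[OF _ mult_nonneg_nonneg])
    qed
  qed
  moreover have "Gamma (a + 1) \<ge> 1"
    using Gamma_ge_secant[of 1 "a + 1"] a by simp
  hence "Gamma (a + 1) * exp (-L) \<ge> 1 * exp (-L)" by (intro mult_right_mono) auto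
  ultimately have "Gamma (a + 1) * (1 - exp (-L)) \<le> Gamma (a + 1) * bessel_ratio (a + 1/2) (L/2)"
    unfolding right_diff_distrib by linarith
  thus ?thesis using a by simp
qed

text \<open>For negative \<open>a\<close> the Taylor coefficients of \<open>(1 - y)\<^sup>a\<close> are positive, so the Gamma integrals of the quadratic Taylor polynomial may be
  extended to the whole half-line. The cubic remainder contributes \<open>4/3 * 6/7 * (2 - 11/16) = 3/2\<close> times
  \<open>b * (1 + b) * Gamma (a + 3) / L\<^sup>2\<close>, the quadratic term \<open>1/2\<close> times it, and together they give exactly the factor \<open>2\<close>.\<close>
lemma bessel_ratio_le_quadratic:
  assumes a: "-1/2 \<le> a" "a < 0" and L: "L > 0"
  shows "bessel_ratio (a + 1/2) (L/2) \<le> 1 + \<bar>a\<bar> * (a + 1) / L + 2 * (\<bar>a\<bar> * (1 - a) * (a + 1) * (a + 2)) / L\<^sup>2"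
proof -
  define b where "b = - a"
  have b: "0 < b" "b \<le> 1/2" "a = - b" using a by (auto simp: b_def)
  define c where "c = 4/3 * b * (1 + b)"
  define S where "S = 6/7 * Gamma (a + 3)"
  have c: "c > 0" using b by (simp add: c_def)
  have "Gamma (a + 1) * bessel_ratio (a + 1/2) (L/2) \<le>
          Gamma (a + 1) + b / L * Gamma (a + 1 + 1) + b * (1 + b) / (2 * L\<^sup>2) * Gamma (a + 2 + 1)
            + c * S / L ^ 3 * ((2 - 11/16) * L)"
  proof (rule has_integral_le)
    show "((\<lambda>s. s powr a * exp (-s) + b / L * (s powr (a + 1) * exp (-s))
                + b * (1 + b) / (2 * L\<^sup>2) * (s powr (a + 2) * exp (-s))
                + c * S / L ^ 3 * (if s < L then 1 / sqrt (1 - s/L) - 11/16 else 0)) has_integral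
           (Gamma (a + 1) + b / L * Gamma (a + 1 + 1) + b * (1 + b) / (2 * L\<^sup>2) * Gamma (a + 2 + 1)
            + c * S / L ^ 3 * ((2 - 11/16) * L))) {0..}"
      using a L by (intro has_integral_add has_integral_mult_right has_integral_Gamma_powr
                          has_integral_inverse_sqrt) auto
    show "((\<lambda>s. if s \<le> L then s powr a * (1 - s/L) powr a * exp (-s) else 0) has_integral
             (Gamma (a + 1) * bessel_ratio (a + 1/2) (L/2))) {0..}"
      using a L by (intro bessel_ratio_integral) auto
    fix s :: real assume "s \<in> {0..}"
    hence s: "s \<ge> 0" by simp
    define y where "y = s / L"
    have y: "s = L * y" "0 \<le> y" using s L by (auto simp: y_def)
    define m where "m = s powr a * exp (-s)"
    have m: "m \<ge> 0" by (simp add: m_def)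
    have eq: "s powr a * exp (-s) + b / L * (s powr (a + 1) * exp (-s))
                + b * (1 + b) / (2 * L\<^sup>2) * (s powr (a + 2) * exp (-s)) =
              m * (1 + b * y + b * (1 + b) / 2 * y\<^sup>2)"
    proof -
      have "s powr (a + 1) * exp (-s) = m * (L * y)" "s powr (a + 2) * exp (-s) = m * (L * y)\<^sup>2"
        unfolding y(1)[symmetric] m_def using s by (simp_all add: powr_add)
      thus ?thesis unfolding m_def[symmetric] using L
        by (simp add: field_simps power2_eq_square)
    qed
    show "(if s \<le> L then s powr a * (1 - s/L) powr a * exp (-s) else 0) \<le>
          s powr a * exp (-s) + b / L * (s powr (a + 1) * exp (-s))
                + b * (1 + b) / (2 * L\<^sup>2) * (s powr (a + 2) * exp (-s))
                + c * S / L ^ 3 * (if s < L then 1 / sqrt (1 - s/L) - 11/16 else 0)"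
    proof (cases "s < L")
      case True
      hence y1: "y < 1" using L by (simp add: y_def)
      define r where "r = 1 / sqrt (1 - y) - 11/16"
      have "1 \<le> 1 / sqrt (1 - y)" using y y1 by simp
      hence r: "r \<ge> 0" unfolding r_def by simp
      have "m * L ^ 3 * y ^ 3 \<le> S"
        using powr_times_exp_minus_le_Gamma[of s b] s b unfolding m_def S_def
        by (simp add: y(1) power_mult_distrib mult_ac)
      hence "m * y ^ 3 \<le> S / L ^ 3" using L by (simp add: field_simps)
      hence "c * r * (m * y ^ 3) \<le> c * r * (S / L ^ 3)" using c r by (intro mult_left_mono) auto
      moreover have "m * (1 - y) powr a \<le> m * (1 + b * y + b * (1 + b) / 2 * y\<^sup>2 + c * (y ^ 3 * r))"
        using one_minus_powr_minus_le_cubic[of y b] y y1 b m unfolding c_def r_def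
        by (intro mult_left_mono) auto
      ultimately have "m * (1 - y) powr a \<le> m * (1 + b * y + b * (1 + b) / 2 * y\<^sup>2) + c * S / L ^ 3 * r"
        by (simp add: algebra_simps)
      thus ?thesis unfolding eq using True by (simp add: m_def y_def r_def mult_ac)
    next
      case False
      thus ?thesis unfolding eq using m y b by (auto intro!: mult_nonneg_nonneg add_nonneg_nonneg)
    qed
  qed
  also have "\<dots> = Gamma (a + 1) * (1 + b * (a + 1) / L + 2 * (b * (1 + b) * (a + 1) * (a + 2)) / L\<^sup>2)"
  proof -
    define g where "g = Gamma (a + 1)"
    have G: "Gamma (a + 3) = (a + 2) * ((a + 1) * g)" "Gamma (a + 2 + 1) = (a + 2) * ((a + 1) * g)"
      "Gamma (a + 1 + 1) = (a + 1) * g"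
      using Gamma_plus1_pos[of "a + 1"] Gamma_plus1_pos[of "a + 2"] a by (simp_all add: add_ac g_def)
    have cubic: "4/3 * b * (1 + b) * (6/7 * q) / L ^ 3 * ((2 - 11/16) * L) = 3/2 * (b * (1 + b) * q / L\<^sup>2)" for q
      using L by (simp add: power2_eq_square power3_eq_cube)
    have quadratic: "b * (1 + b) / (2 * L\<^sup>2) * q = 1/2 * (b * (1 + b) * q / L\<^sup>2)" for q
      by simp
    have "g + b / L * ((a + 1) * g) + 1/2 * v + 3/2 * v = g + b * (a + 1) / L * g + 2 * v" for v
      by simp
    moreover have "2 * (b * (1 + b) * ((a + 2) * ((a + 1) * g)) / L\<^sup>2) =
        2 * (b * (1 + b) * (a + 1) * (a + 2)) / L\<^sup>2 * g"
      by simp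
    ultimately show ?thesis unfolding S_def c_def G g_def[symmetric] cubic quadratic
      by (simp only: distrib_left mult_1_right mult.commute[of g])
  qed
  finally have "bessel_ratio (a + 1/2) (L/2) \<le> 1 + b * (a + 1) / L + 2 * (b * (1 + b) * (a + 1) * (a + 2)) / L\<^sup>2"
    by (rule mult_left_le_imp_le) (use a in auto)
  moreover have "\<bar>a\<bar> = b" "1 - a = 1 + b" using b by auto
  ultimately show ?thesis by (simp only:)
qed

text \<open>Here three quantities compete for the second order term: the quadratic Taylor term, the cubic remainder, and the excess of the tail over \<open>e\<^sup>-\<^sup>L\<close>.
  Relative to \<open>a * (1 - a) * (a + 1) / L\<^sup>2\<close> they are at most \<open>(a + 2) / 2\<close>, \<open>(1 - a/2) * 9/10 * S\<close> and \<open>135/100\<close>, and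
  their sum stays below \<open>2 * (a + 2)\<close>. The tail is handled with \<open>L\<^sup>a \<le> 1 - a + a * L\<close> and the maximum of \<open>L\<^sup>3 * e\<^sup>-\<^sup>L\<close>.\<close>
lemma bessel_ratio_ge_quadratic:
  assumes a: "0 < a" "a < 1" and L: "L > 0"
  shows "1 - bessel_ratio (a + 1/2) (L/2) \<le>
           exp (-L) + a * (a + 1) / L + 2 * (a * (1 - a) * (a + 1) * (a + 2)) / L\<^sup>2"
proof -
  define c where "c = a * (1 - a) * (1 - a / 2) * (9 / 20)"
  define S where "S = 135/100 + 335/100 * a"
  define g where "g = Gamma (a + 1)"
  define R where "R = bessel_ratio (a + 1/2) (L/2)"
  have c: "c > 0" using a by (simp add: c_def)
  have g: "g > 0" "g * (a + 1) \<ge> 1"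
    using Gamma_ge_secant[of 1 "a + 2"] Gamma_plus1_pos[of "a + 1"] a by (simp_all add: g_def add_ac mult_ac)
  have "Gamma (a + 1) - a / L * Gamma (a + 1 + 1) - a * (1 - a) / (2 * L\<^sup>2) * Gamma (a + 2 + 1)
            - c * S / L ^ 3 * ((2 - 0) * L) - (1 - a) * L powr a * exp (-L) \<le> Gamma (a + 1) * R"
  proof (rule has_integral_le)
    show "((\<lambda>s. s powr a * exp (-s) - a / L * (s powr (a + 1) * exp (-s))
                - a * (1 - a) / (2 * L\<^sup>2) * (s powr (a + 2) * exp (-s))
                - c * S / L ^ 3 * (if s < L then 1 / sqrt (1 - s/L) - 0 else 0)
                - (1 - a) * L powr a * (if L \<le> s then exp (-s) else 0)) has_integral
           (Gamma (a + 1) - a / L * Gamma (a + 1 + 1) - a * (1 - a) / (2 * L\<^sup>2) * Gamma (a + 2 + 1)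
            - c * S / L ^ 3 * ((2 - 0) * L) - (1 - a) * L powr a * exp (-L))) {0..}"
      using a L by (intro has_integral_diff has_integral_mult_right has_integral_Gamma_powr
                          has_integral_inverse_sqrt has_integral_exp_tail) auto
    show "((\<lambda>s. if s \<le> L then s powr a * (1 - s/L) powr a * exp (-s) else 0) has_integral
             (Gamma (a + 1) * R)) {0..}"
      unfolding R_def using a L by (intro bessel_ratio_integral) auto
    fix s :: real assume "s \<in> {0..}"
    hence s: "s \<ge> 0" by simp
    define y where "y = s / L"
    have y: "s = L * y" "0 \<le> y" using s L by (auto simp: y_def)
    define m where "m = s powr a * exp (-s)"
    have m: "m \<ge> 0" by (simp add: m_def)
    have eq: "s powr a * exp (-s) - a / L * (s powr (a + 1) * exp (-s))
                - a * (1 - a) / (2 * L\<^sup>2) * (s powr (a + 2) * exp (-s)) =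
              m * (1 - a * y - a * (1 - a) / 2 * y\<^sup>2)"
    proof -
      have "s powr (a + 1) * exp (-s) = m * (L * y)" "s powr (a + 2) * exp (-s) = m * (L * y)\<^sup>2"
        unfolding y(1)[symmetric] m_def using s by (simp_all add: powr_add)
      thus ?thesis unfolding m_def[symmetric] using L
        by (simp add: field_simps power2_eq_square)
    qed
    show "s powr a * exp (-s) - a / L * (s powr (a + 1) * exp (-s))
                - a * (1 - a) / (2 * L\<^sup>2) * (s powr (a + 2) * exp (-s))
                - c * S / L ^ 3 * (if s < L then 1 / sqrt (1 - s/L) - 0 else 0)
                - (1 - a) * L powr a * (if L \<le> s then exp (-s) else 0) \<le>
          (if s \<le> L then s powr a * (1 - s/L) powr a * exp (-s) else 0)"
    proof (cases "s < L")
      case True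
      hence y1: "y < 1" using L by (simp add: y_def)
      define r where "r = 1 / sqrt (1 - y)"
      have r: "r \<ge> 0" using y1 by (simp add: r_def)
      have "m * L ^ 3 * y ^ 3 \<le> S"
        using powr_times_exp_minus_le_affine[of s a] s a unfolding m_def S_def
        by (simp add: y(1) power_mult_distrib mult_ac)
      hence "m * y ^ 3 \<le> S / L ^ 3" using L by (simp add: field_simps)
      hence "c * r * (m * y ^ 3) \<le> c * r * (S / L ^ 3)" using c r by (intro mult_left_mono) auto
      moreover have "m * (1 - a * y - a * (1 - a) / 2 * y\<^sup>2 - c * (y ^ 3 * r)) \<le> m * (1 - y) powr a"
        using one_minus_powr_ge_cubic[of y a] y y1 a m unfolding c_def r_def
        by (intro mult_left_mono) auto
      ultimately have "m * (1 - a * y - a * (1 - a) / 2 * y\<^sup>2) - c * S / L ^ 3 * r \<le> m * (1 - y) powr a"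
        by (simp add: algebra_simps)
      thus ?thesis unfolding eq using True by (simp add: m_def y_def r_def mult_ac)
    next
      case False
      have "m * (1 - a * y - a * (1 - a) / 2 * y\<^sup>2) \<le> m * (1 - a * y)"
        using m a by (intro mult_left_mono) auto
      also have "\<dots> = s powr a * (1 - a * (s/L)) * exp (-s)" by (simp add: m_def y_def)
      also have "\<dots> \<le> (1 - a) * L powr a * exp (-s)"
        using False a L by (intro mult_right_mono powr_tail_le) auto
      finally show ?thesis unfolding eq using False by auto
    qed
  qed
  also have "Gamma (a + 1 + 1) = (a + 1) * g"
    unfolding g_def using a by (intro Gamma_plus1_pos) auto
  also have "Gamma (a + 2 + 1) = (a + 2) * ((a + 1) * g)"
    unfolding g_def using Gamma_plus1_pos[of "a + 1"] Gamma_plus1_pos[of "a + 2"] a by (simp add: add_ac)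
  finally have main: "g - a / L * ((a + 1) * g) - a * (1 - a) / (2 * L\<^sup>2) * ((a + 2) * ((a + 1) * g))
            - c * S / L ^ 3 * ((2 - 0) * L) - (1 - a) * L powr a * exp (-L) \<le> g * R"
    unfolding g_def by simp
  \<comment> \<open>The common factor of all second order contributions.\<close>
  define k where "k = a * (1 - a) * (a + 1)"
  define X where "X = 2 * c * S / L\<^sup>2 + (1 - a) * L powr a * exp (-L)"
  have X0: "X \<ge> 0" unfolding X_def S_def using a c by (intro add_nonneg_nonneg mult_nonneg_nonneg divide_nonneg_nonneg) auto
  have "g * (1 - R) \<le> g * (a * (a + 1) / L + k * ((a + 2) / 2) / L\<^sup>2) + X"
    using main L unfolding X_def k_def by (simp add: field_simps power2_eq_square power3_eq_cube)
  also have "X * 1 \<le> X * (g * (a + 1))" using X0 g by (intro mult_left_mono) auto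
  hence "g * (a * (a + 1) / L + k * ((a + 2) / 2) / L\<^sup>2) + X \<le>
         g * (a * (a + 1) / L + k * ((a + 2) / 2) / L\<^sup>2 + X * (a + 1))"
    by (simp add: algebra_simps)
  finally have "1 - R \<le> a * (a + 1) / L + k * ((a + 2) / 2) / L\<^sup>2 + X * (a + 1)"
    using g(1) by simp
  also have "X * (a + 1) \<le> exp (-L) + k * (135/100) / L\<^sup>2 + k * ((1 - a/2) * (9/10) * S) / L\<^sup>2"
  proof -
    have "L ^ 3 * exp (-L) \<le> 135/100" using L by (intro power3_times_exp_minus_le) auto
    hence E: "L * exp (-L) \<le> 135/100 / L\<^sup>2" using L by (simp add: field_simps power2_eq_square power3_eq_cube)
    have "(1 - a) * (a + 1) * L powr a \<le> (1 - a) * (a + 1) * (1 - a + a * L)"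
      using a L by (intro mult_left_mono powr_le_weighted_mean) auto
    also have "\<dots> = (1 - a) * ((1 - a) * (a + 1)) + k * L" unfolding k_def by algebra
    also have "(1 - a) * ((1 - a) * (a + 1)) \<le> 1 * 1"
      using a by (intro mult_mono mult_nonneg_nonneg) (auto simp: algebra_simps)
    finally have "(1 - a) * (a + 1) * L powr a * exp (-L) \<le> (1 + k * L) * exp (-L)"
      by (intro mult_right_mono) auto
    also have "\<dots> = exp (-L) + k * (L * exp (-L))" by (simp add: algebra_simps)
    also have "\<dots> \<le> exp (-L) + k * (135/100 / L\<^sup>2)"
      using E a by (intro add_left_mono mult_left_mono) (auto simp: k_def)
    finally have "(1 - a) * (a + 1) * L powr a * exp (-L) \<le> exp (-L) + k * (135/100) / L\<^sup>2" by simp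
    moreover have "X * (a + 1) = (1 - a) * (a + 1) * L powr a * exp (-L) + k * ((1 - a/2) * (9/10) * S) / L\<^sup>2"
      unfolding X_def c_def k_def using L by (simp add: field_simps)
    ultimately show ?thesis by simp
  qed
  also have "a * (a + 1) / L + k * ((a + 2) / 2) / L\<^sup>2 +
      (exp (-L) + k * (135/100) / L\<^sup>2 + k * ((1 - a/2) * (9/10) * S) / L\<^sup>2) =
      exp (-L) + a * (a + 1) / L + k * ((a + 2) / 2 + 135/100 + (1 - a/2) * (9/10) * S) / L\<^sup>2"
    by (simp add: add_divide_distrib distrib_left)
  also have "\<dots> \<le> exp (-L) + a * (a + 1) / L + k * (2 * (a + 2)) / L\<^sup>2"
  proof -
    \<comment> \<open>The difference of the two sides is a quadratic polynomial in \<open>a\<close> with positive minimum, at \<open>a = 121/402\<close>.\<close>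
    have "(a + 2) / 2 + 135/100 + (1 - a/2) * (9/10) * S =
            2 * (a + 2) - (603/400 * (a - 121/402)\<^sup>2 + (435/1000 - 603/400 * (121/402)\<^sup>2))"
      unfolding S_def by (simp add: field_simps power2_eq_square)
    also have "\<dots> \<le> 2 * (a + 2)" 
    proof -
      have "(0::real) \<le> 435/1000 - 603/400 * (121/402)\<^sup>2" by (simp add: power_divide)
      thus ?thesis using zero_le_power2[of "a - 121/402"] by linarith
    qed
    finally show ?thesis using a
      by (intro add_left_mono divide_right_mono mult_left_mono) (auto simp: k_def)
  qed
  finally show ?thesis unfolding R_def k_def by (simp add: mult_ac)
qed

section \<open>Comparison with the error bound\<close>

lemma Psi_G_ge_1:
  assumes "\<nu> \<ge> 1/2 \<and> 2 * x > \<nu> - 1/2 \<or> 0 \<le> \<nu> \<and> \<nu> < 1/2 \<and> 2 * x > \<nu> + 3/2"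
  shows "Psi_G \<nu> x \<ge> 1"
proof -
  have ge1: "1 \<le> t powr (- r)" if "0 < t" "t \<le> 1" "0 \<le> r" for t r :: real
    using powr_mono2'[of "-r" t 1] that by simp
  from assms show ?thesis
  proof (elim disjE conjE)
    assume \<nu>: "\<nu> \<ge> 1/2" "2 * x > \<nu> - 1/2"
    have "1 \<le> (1 - (\<nu> - 1/2) / (2 * x)) powr (- (2 * \<nu> + 1))"
      using \<nu> by (intro ge1) (auto simp: field_simps)
    moreover have "- (2 * \<nu> + 1) = - 2 * \<nu> - 1" by simp
    ultimately show ?thesis using \<nu> unfolding Psi_G_def by simp
  next
    assume \<nu>: "0 \<le> \<nu>" "\<nu> < 1/2" "2 * x > \<nu> + 3/2"
    have "1 * 1 \<le> (1 - (\<nu> + 3/2) / (2 * x)) powr (- (\<nu> + 3/2)) * (1 + (2 * \<nu> + 2) / x)"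
      using \<nu> by (intro mult_mono ge1) (auto simp: field_simps)
    thus ?thesis using \<nu> by (simp add: Psi_G_def algebra_simps)
  qed
qed

text \<open>\<open>Psi\<close> in terms of \<open>a = \<nu> - 1/2\<close> and \<open>L = 2 * x\<close>, with \<open>G\<close> and the factor \<open>1 + e\<^sup>-\<^sup>2\<^sup>x\<close> both lowered to 1.\<close>
lemma Psi_ge:
  fixes a L :: real
  assumes a: "a > -1" and L: "L > 0" and G: "Psi_G (a + 1/2) (L/2) \<ge> 1"
  shows "exp (-L) + \<bar>a\<bar> * (a + 1) / L + 2 * (\<bar>a\<bar> * \<bar>1 - a\<bar> * (a + 1) * (a + 2)) / L\<^sup>2 \<le> Psi (a + 1/2) (L/2)"
proof -
  define A where "A = \<bar>a\<bar> * (a + 1) / L"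
  define B where "B = 2 * (\<bar>a\<bar> * \<bar>1 - a\<bar> * (a + 1) * (a + 2)) / L\<^sup>2"
  have AB: "A \<ge> 0" "B \<ge> 0" unfolding A_def B_def using a L by auto
  have first: "\<bar>4 * (a + 1/2)\<^sup>2 - 1\<bar> = 4 * (\<bar>a\<bar> * (a + 1))"
  proof -
    have "4 * (a + 1/2)\<^sup>2 - 1 = 4 * (a * (a + 1))" by (simp add: power2_eq_square algebra_simps)
    thus ?thesis using a by (simp add: abs_mult)
  qed
  have second: "\<bar>(4 * (a + 1/2)\<^sup>2 - 1) * (4 * (a + 1/2)\<^sup>2 - 9)\<bar> = 16 * (\<bar>a\<bar> * \<bar>1 - a\<bar> * (a + 1) * (a + 2))"
  proof -
    have "4 * (a + 1/2)\<^sup>2 - 9 = 4 * ((a - 1) * (a + 2))" by (simp add: power2_eq_square algebra_simps)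
    hence "\<bar>4 * (a + 1/2)\<^sup>2 - 9\<bar> = 4 * (\<bar>1 - a\<bar> * (a + 2))"
      using a by (simp add: abs_mult abs_minus_commute)
    thus ?thesis unfolding abs_mult first by simp
  qed
  have "4 * p / (8 * (L/2)) = p / L" "16 * p / (32 * (L/2)\<^sup>2) = 2 * p / L\<^sup>2" for p
    using L by (simp_all add: power2_eq_square)
  hence "Psi (a + 1/2) (L/2) = exp (-L) + (A + Psi_G (a + 1/2) (L/2) * B) * (1 + exp (-L))"
    unfolding Psi_def first second A_def B_def by simp
  moreover have "A + B \<le> A + Psi_G (a + 1/2) (L/2) * B" using G AB by (simp add: mult_le_cancel_right1)
  moreover have "(A + Psi_G (a + 1/2) (L/2) * B) * 1 \<le> (A + Psi_G (a + 1/2) (L/2) * B) * (1 + exp (-L))"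
    using G AB by (intro mult_left_mono) auto
  ultimately show ?thesis unfolding A_def B_def by simp
qed

lemma bessel_ratio_error_le_Psi:
  fixes \<nu> x :: real
  assumes "\<nu> \<ge> 1/2 \<and> 2 * x > \<nu> - 1/2 \<or> 0 \<le> \<nu> \<and> \<nu> < 1/2 \<and> 2 * x > \<nu> + 3/2"
  shows "\<bar>bessel_ratio \<nu> x - 1\<bar> \<le> Psi \<nu> x"
proof -
  define a L where "a = \<nu> - 1/2" and "L = 2 * x"
  have \<nu>x: "\<nu> = a + 1/2" "x = L/2" by (simp_all add: a_def L_def)
  have aL: "a > -1" "L > 0" using assms unfolding a_def L_def by auto
  define R where "R = bessel_ratio (a + 1/2) (L/2)"
  have Psi: "exp (-L) + \<bar>a\<bar> * (a + 1) / L + 2 * (\<bar>a\<bar> * \<bar>1 - a\<bar> * (a + 1) * (a + 2)) / L\<^sup>2 \<le> Psi (a + 1/2) (L/2)"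
    using Psi_ge[OF aL] Psi_G_ge_1[OF assms] unfolding \<nu>x by blast
  have nonneg: "\<bar>a\<bar> * (a + 1) / L \<ge> 0" "2 * (\<bar>a\<bar> * \<bar>1 - a\<bar> * (a + 1) * (a + 2)) / L\<^sup>2 \<ge> 0"
    using aL by auto
  consider "a \<ge> 1" | "0 < a" "a < 1" | "a = 0" | "-1/2 \<le> a" "a < 0" "L > 1"
    using assms unfolding a_def L_def by linarith
  hence "\<bar>R - 1\<bar> \<le> exp (-L) + \<bar>a\<bar> * (a + 1) / L + 2 * (\<bar>a\<bar> * \<bar>1 - a\<bar> * (a + 1) * (a + 2)) / L\<^sup>2"
  proof cases
    case 1
    hence "R \<le> 1" "1 - \<bar>a\<bar> * (a + 1) / L \<le> R"
      using bessel_ratio_le_1[of a L] bessel_ratio_ge_linear[of a L] aL unfolding R_def by auto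
    thus ?thesis using nonneg exp_ge_zero[of "-L"] by linarith
  next
    case 2
    thus ?thesis
      using bessel_ratio_le_1[of a L] bessel_ratio_ge_quadratic[of a L] aL unfolding R_def by auto
  next
    case 3
    thus ?thesis
      using bessel_ratio_le_1[of a L] bessel_ratio_ge_minus_exp[of a L] aL unfolding R_def by auto
  next
    case 4
    have "L powr a \<le> 1" using 4 powr_mono2'[of a 1 L] by simp
    hence "1 - exp (-L) \<le> R" using bessel_ratio_ge_minus_exp[of a L] 4 aL unfolding R_def by auto
    moreover have "\<bar>1 - a\<bar> = 1 - a" using 4 by simp
    hence "R \<le> 1 + \<bar>a\<bar> * (a + 1) / L + 2 * (\<bar>a\<bar> * \<bar>1 - a\<bar> * (a + 1) * (a + 2)) / L\<^sup>2"
      using bessel_ratio_le_quadratic[of a L] 4 aL unfolding R_def by simp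
    ultimately show ?thesis using nonneg exp_ge_zero[of "-L"] by linarith
  qed
  thus ?thesis using Psi unfolding R_def \<nu>x by linarith
qed

theorem theorem1:
  shows "(\<forall>\<nu> x\<^sub>0 :: real.
            (\<nu> > 1/2 \<and> 2 * x\<^sub>0 > \<nu> - 1/2) \<or> (0 \<le> \<nu> \<and> \<nu> < 1/2 \<and> 2 * x\<^sub>0 > \<nu> + 3/2) \<longrightarrow>
            (\<forall>x \<ge> x\<^sub>0. \<bar>bessel_I \<nu> x / (exp x / sqrt (2 * pi * x)) - 1\<bar> \<le> Psi \<nu> x))
       \<and> (\<forall>\<nu> :: real. \<nu> = 1/2 \<longrightarrow>
            (\<forall>x > 0. \<bar>bessel_I \<nu> x / (exp x / sqrt (2 * pi * x)) - 1\<bar> \<le> Psi \<nu> x \<and>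
                     Psi \<nu> x = exp (- 2 * x)))"
proof (intro conjI allI impI)
  fix \<nu> x\<^sub>0 x :: real
  assume "\<nu> > 1/2 \<and> 2 * x\<^sub>0 > \<nu> - 1/2 \<or> 0 \<le> \<nu> \<and> \<nu> < 1/2 \<and> 2 * x\<^sub>0 > \<nu> + 3/2" "x \<ge> x\<^sub>0"
  thus "\<bar>bessel_I \<nu> x / (exp x / sqrt (2 * pi * x)) - 1\<bar> \<le> Psi \<nu> x"
    unfolding bessel_ratio_def[symmetric] by (intro bessel_ratio_error_le_Psi) auto
next
  fix \<nu> x :: real
  assume "\<nu> = 1/2" "x > 0"
  thus "\<bar>bessel_I \<nu> x / (exp x / sqrt (2 * pi * x)) - 1\<bar> \<le> Psi \<nu> x"
    unfolding bessel_ratio_def[symmetric] by (intro bessel_ratio_error_le_Psi) auto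
  show "Psi \<nu> x = exp (- 2 * x)"
    unfolding \<open>\<nu> = 1/2\<close> by (simp add: Psi_def power2_eq_square)
qed

end
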